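(* Let $\Omega\subset\mathbb{R}^n$ be a convex subset, and let $A\subset\mathbb{R}^n$ be a closed subset of dimension $\le\dim\Omega-2$. Then for continuous functions $f:\Omega-A\to\mathbb{R}$, the following three properties are equivalent: $f$ is convex on $\Omega-A$; $f$ is locally convex on $\Omega-A$; $f$ is interval convex on $\Omega-A$.
   Context: All functions are real valued. For a function $f$ on a (not necessarily convex) set $S\subset\mathbb{R}^n$: (1) $f$ is convex if $f(x)\le \lambda_1 f(x_1)+\cdots+\lambda_k f(x_k)$ whenever $x_1,\dots,x_k\in S$, $\lambda_i\ge 0$, $\lambda_1+\cdots+\lambda_k=1$, and $x=\lambda_1x_1+\cdots+\lambda_kx_k$ also lies in $S$; (2) $f$ is locally convex if for every $x\in S$ there is a ball $B$ around $x$ such that the restriction of $f$ to $B\cap S$ is convex in the sense of (1); (3) $f$ is interval convex if the restriction of $f$ to any interval (straight line segment) contained in $S$ is convex. $\dim\Omega$ is the dimension of the affine hull of $\Omega$. The dimension of $A$ may be defined in various ways, depending on whether $A$ is a union of finitely many submanifolds, a polyhedron, or some other topologically nice subset; the meaning of the dimension condition is only its "general position" consequence: if $x,y$ (in $\Omega$) are outside $A$, then $y$ can be moved by an arbitrarily small distance (within $\Omega$) so that the straight line connecting $x$ and $y$ avoids $A$. *)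

theory Defs
  imports "HOL-Analysis.Analysis"
begin

text \<open>
  The notion \<^const>\<open>convex_on\<close> of the library requires a convex domain, so that convexity of a
  function on an arbitrary set is introduced here.
\<close>

definition convex_fun_on :: "'a::real_vector set \<Rightarrow> ('a \<Rightarrow> real) \<Rightarrow> bool" where
  "convex_fun_on S f \<longleftrightarrow>
    (\<forall>(k::nat) (c::nat \<Rightarrow> real) (p::nat \<Rightarrow> 'a).
       (\<forall>i<k. p i \<in> S \<and> 0 \<le> c i) \<longrightarrow> (\<Sum>i<k. c i) = 1 \<longrightarrow> (\<Sum>i<k. c i *\<^sub>R p i) \<in> S \<longrightarrow>
       f (\<Sum>i<k. c i *\<^sub>R p i) \<le> (\<Sum>i<k. c i * f (p i)))"

definition locally_convex_fun_on :: "'a::real_normed_vector set \<Rightarrow> ('a \<Rightarrow> real) \<Rightarrow> bool" where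
  "locally_convex_fun_on S f \<longleftrightarrow> (\<forall>x\<in>S. \<exists>r>0. convex_fun_on (ball x r \<inter> S) f)"

definition interval_convex_fun_on :: "'a::real_vector set \<Rightarrow> ('a \<Rightarrow> real) \<Rightarrow> bool" where
  "interval_convex_fun_on S f \<longleftrightarrow>
    (\<forall>a b. closed_segment a b \<subseteq> S \<longrightarrow> convex_fun_on (closed_segment a b) f)"

text \<open>
  The condition \<open>dim A \<le> dim \<Omega> - 2\<close> on a closed set \<open>A\<close>. No particular notion of dimension is fixed
  for \<open>A\<close>; the condition stands for its general position consequence, which is what is required
  here. That it follows from the inequality for concrete notions of dimension is shown in
  \<open>general_position_in_affine\<close> (finite polyhedral complexes) and \<open>general_position_in_differentiable\<close>
  (countable unions of parametrised submanifolds
  of positive dimension, for full-dimensional \<open>\<Omega>\<close>) below. The straight line connecting two points is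
  the segment between them.
\<close>

definition general_position_in :: "'a::real_normed_vector set \<Rightarrow> 'a set \<Rightarrow> bool" where
  "general_position_in A \<Omega> \<longleftrightarrow>
    (\<forall>x\<in>\<Omega> - A. \<forall>y\<in>\<Omega> - A. \<forall>e>0. \<exists>y'\<in>\<Omega>. dist y' y < e \<and> closed_segment x y' \<inter> A = {})"

lemma convex_fun_on_iff_convex_on:
  assumes "convex S"
  shows "convex_fun_on S f \<longleftrightarrow> convex_on S f"
proof
  assume f: "convex_fun_on S f"
  show "convex_on S f"
  proof (rule convex_onI)
    fix t :: real and x y
    assume t: "0 < t" "t < 1" and xy: "x \<in> S" "y \<in> S"
    define c where "c = (\<lambda>i::nat. if i = 0 then 1 - t else t)"
    define p where "p = (\<lambda>i::nat. if i = 0 then x else y)"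
    have "(\<Sum>i<2. c i *\<^sub>R p i) = (1 - t) *\<^sub>R x + t *\<^sub>R y"
      by (simp add: c_def p_def eval_nat_numeral)
    moreover have "(\<Sum>i<2. c i * f (p i)) = (1 - t) * f x + t * f y" "(\<Sum>i<2. c i) = 1"
      by (simp_all add: c_def p_def eval_nat_numeral)
    moreover have "(1 - t) *\<^sub>R x + t *\<^sub>R y \<in> S"
      using assms xy t by (simp add: convex_alt)
    moreover have "\<forall>i<2. p i \<in> S \<and> 0 \<le> c i"
      using xy t by (auto simp: c_def p_def)
    ultimately show "f ((1 - t) *\<^sub>R x + t *\<^sub>R y) \<le> (1 - t) * f x + t * f y"
      using f[unfolded convex_fun_on_def, rule_format, of 2 p c] by simp
  qed (fact assms)
next
  assume f: "convex_on S f"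
  show "convex_fun_on S f"
    unfolding convex_fun_on_def
  proof (intro allI impI)
    fix k and c :: "nat \<Rightarrow> real" and p :: "nat \<Rightarrow> 'a"
    assume *: "\<forall>i<k. p i \<in> S \<and> 0 \<le> c i" "(\<Sum>i<k. c i) = 1"
    then have "k \<noteq> 0" by (intro notI) simp
    then show "f (\<Sum>i<k. c i *\<^sub>R p i) \<le> (\<Sum>i<k. c i * f (p i))"
      using * f by (intro convex_on_sum) auto
  qed
qed

lemma general_position_in_affine:
  fixes \<Omega> A :: "'a::euclidean_space set"
  assumes "convex \<Omega>" "finite F" "A \<subseteq> \<Union>F" "\<And>T. T \<in> F \<Longrightarrow> aff_dim T \<le> aff_dim \<Omega> - 2"
  shows "general_position_in A \<Omega>"
  unfolding general_position_in_def
proof (intro ballI allI impI)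
  fix x y and e :: real
  assume x: "x \<in> \<Omega> - A" and y: "y \<in> \<Omega> - A" and e: "e > 0"
  define H where "H T = affine hull (insert x T)" for T
  have "\<exists>U. open U \<and> U \<subseteq> ball y e \<and> U \<inter> \<Omega> \<noteq> {} \<and> U \<inter> \<Union>(H ` F) = {}"
    using assms(2,4)
  proof (induction F)
    case empty
    have "y \<in> ball y e \<inter> \<Omega>" using y e by simp
    then have "ball y e \<inter> \<Omega> \<noteq> {}" by blast
    then show ?case by (intro exI[of _ "ball y e"]) simp
  next
    case (insert T F)
    then obtain U where U: "open U" "U \<subseteq> ball y e" "U \<inter> \<Omega> \<noteq> {}" "U \<inter> \<Union>(H ` F) = {}"
      by auto
    have "aff_dim (\<Omega> \<inter> U) = aff_dim \<Omega>"
      using U assms(1) affine_hull_convex_Int_open[of \<Omega> U] by (metis aff_dim_affine_hull inf_commute)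
    moreover have "aff_dim (H T) < aff_dim \<Omega>"
      using insert.prems[of T] by (auto simp: H_def aff_dim_insert)
    ultimately have "\<not> \<Omega> \<inter> U \<subseteq> H T"
      using aff_dim_subset[of "\<Omega> \<inter> U" "H T"] by linarith
    moreover have "closed (H T)"
      by (simp add: H_def closed_affine_hull)
    ultimately show ?case
      using U by (intro exI[of _ "U - H T"]) (auto simp: open_Diff)
  qed
  then obtain y' where y': "y' \<in> \<Omega>" "y' \<in> ball y e" "y' \<notin> \<Union>(H ` F)" by blast
  have "a \<notin> A" if a: "a \<in> closed_segment x y'" for a
  proof
    assume "a \<in> A"
    then obtain T where T: "T \<in> F" "a \<in> T" using assms(3) by auto
    from a obtain s where s: "a = (1 - s) *\<^sub>R x + s *\<^sub>R y'" by (auto simp: in_segment)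
    have "s \<noteq> 0" using s x \<open>a \<in> A\<close> by auto
    then have "y' = (1 - 1/s) *\<^sub>R x + (1/s) *\<^sub>R a"
      by (simp add: s algebra_simps)
    moreover have "x \<in> H T" "a \<in> H T" using T by (auto simp: H_def hull_inc)
    ultimately have "y' \<in> H T"
      using mem_affine[of "H T" x a "1 - 1/s" "1/s"] by (simp add: H_def)
    then show False using y' T by auto
  qed
  then show "\<exists>y'\<in>\<Omega>. dist y' y < e \<and> closed_segment x y' \<inter> A = {}"
    using y' by (intro bexI[of _ y']) (auto simp: dist_commute)
qed

lemma general_position_in_differentiable:
  fixes \<Omega> A :: "'a::euclidean_space set" and g :: "'i \<Rightarrow> 'b::euclidean_space \<Rightarrow> 'a"
  assumes "convex \<Omega>" "aff_dim \<Omega> = int DIM('a)" "countable I" "A \<subseteq> (\<Union>i\<in>I. g i ` V i)"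
    and "\<And>i. i \<in> I \<Longrightarrow> g i differentiable_on V i" and "DIM('b) + 2 \<le> DIM('a)"
  shows "general_position_in A \<Omega>"
  unfolding general_position_in_def
proof (intro ballI allI impI)
  fix x y and e :: real
  assume x: "x \<in> \<Omega> - A" and y: "y \<in> \<Omega> - A" and e: "e > 0"
  define h where "h i = (\<lambda>q::real \<times> 'b. x + fst q *\<^sub>R (g i (snd q) - x))" for i
  have "negligible (h i ` (UNIV \<times> V i))" if i: "i \<in> I" for i
  proof (rule negligible_differentiable_image_lowdim)
    have "snd ` ((UNIV :: real set) \<times> V i) \<subseteq> V i" by auto
    then have "g i differentiable_on snd ` ((UNIV :: real set) \<times> V i)"
      using assms(5)[OF i] differentiable_on_subset by blast
    then have "(\<lambda>q::real \<times> 'b. g i (snd q)) differentiable_on UNIV \<times> V i"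
      by (rule differentiable_on_compose[OF linear_imp_differentiable_on[OF linear_snd]])
    then have "(\<lambda>q::real \<times> 'b. g i (snd q) - x) differentiable_on UNIV \<times> V i"
      by (intro differentiable_on_diff differentiable_on_const)
    then show "h i differentiable_on UNIV \<times> V i"
      unfolding h_def
      by (intro differentiable_on_add[OF differentiable_on_const]
          differentiable_on_scaleR[OF linear_imp_differentiable_on[OF linear_fst]])
  qed (use assms(6) in simp)
  then have neg: "negligible (\<Union>i\<in>I. h i ` (UNIV \<times> V i))"
    using assms(3) by (auto intro!: negligible_countable_Union)
  have "affine hull (\<Omega> \<inter> ball y e) = affine hull \<Omega>"
    using assms(1) y e by (intro affine_hull_convex_Int_open) auto
  also have "\<dots> = UNIV"
    using assms(2) by (simp add: aff_dim_eq_full)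
  finally have "rel_interior (\<Omega> \<inter> ball y e) = interior (\<Omega> \<inter> ball y e)"
    by (rule rel_interior_interior)
  moreover have "y \<in> \<Omega> \<inter> ball y e" using y e by simp
  then have "rel_interior (\<Omega> \<inter> ball y e) \<noteq> {}"
    using assms(1) by (subst rel_interior_eq_empty) (auto intro: convex_Int)
  ultimately have "interior (\<Omega> \<inter> ball y e) \<noteq> {}" by simp
  then have "\<not> negligible (\<Omega> \<inter> ball y e)"
    using open_not_negligible[OF open_interior] interior_subset negligible_subset by metis
  then obtain y' where y': "y' \<in> \<Omega>" "y' \<in> ball y e" "y' \<notin> (\<Union>i\<in>I. h i ` (UNIV \<times> V i))"
    using neg negligible_subset[of "\<Union>i\<in>I. h i ` (UNIV \<times> V i)" "\<Omega> \<inter> ball y e"] by blast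
  have "a \<notin> A" if a: "a \<in> closed_segment x y'" for a
  proof
    assume "a \<in> A"
    then obtain i u where iu: "i \<in> I" "u \<in> V i" "a = g i u" using assms(4) by auto
    from a obtain s where s: "a = (1 - s) *\<^sub>R x + s *\<^sub>R y'" by (auto simp: in_segment)
    have "s \<noteq> 0" using s x \<open>a \<in> A\<close> by auto
    then have "y' = h i (1/s, u)"
      by (simp add: h_def iu(3)[symmetric] s algebra_simps)
    then show False using y' iu by auto
  qed
  then show "\<exists>y'\<in>\<Omega>. dist y' y < e \<and> closed_segment x y' \<inter> A = {}"
    using y' by (intro bexI[of _ y']) (auto simp: dist_commute)
qed

end

theory Submission
  imports Defs
begin

text \<open>
  Local convexity passes to segments: the difference between \<open>f\<close> and its chord is continuous and
  locally midpoint convex, so it has no positive interior maximum. From segments to all convex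
  combinations: by general position and continuity, any two points of the epigraph of \<open>f\<close> can be
  perturbed so that the segment between them stays over \<open>\<Omega> - A\<close>. Hence the closure of the epigraph
  is convex, and by continuity it adds no points over \<open>\<Omega> - A\<close>.
\<close>

lemma convex_fun_on_subset:
  assumes "convex_fun_on S f" "T \<subseteq> S"
  shows "convex_fun_on T f"
  using assms unfolding convex_fun_on_def by (meson subsetD)

lemma convex_fun_onD:
  assumes "convex_fun_on S f" "x \<in> S" "y \<in> S" "(1 - t) *\<^sub>R x + t *\<^sub>R y \<in> S" "0 \<le> t" "t \<le> 1"
  shows "f ((1 - t) *\<^sub>R x + t *\<^sub>R y) \<le> (1 - t) * f x + t * f y"
  using assms(1)[unfolded convex_fun_on_def, rule_format, of 2
      "\<lambda>i. if i = 0 then x else y" "\<lambda>i. if i = 0 then 1 - t else t"] assms(2-)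
  by (simp add: eval_nat_numeral)

text \<open>A continuous \<open>h\<close> attains its maximum. Were it positive, it would be
  attained only inside the interval, and the midpoint inequality fails at the leftmost maximiser:
  \<open>h\<close> is strictly smaller just to the left and no larger to the right.\<close>

lemma locally_midpoint_convex_le_0:
  fixes h :: "real \<Rightarrow> real"
  assumes cont: "continuous_on {0..1} h" and ends: "h 0 = 0" "h 1 = 0"
    and mid: "\<And>s. 0 < s \<Longrightarrow> s < 1 \<Longrightarrow>
      \<exists>\<delta>>0. \<forall>d. 0 < d \<longrightarrow> d < \<delta> \<longrightarrow> d \<le> s \<longrightarrow> d \<le> 1 - s \<longrightarrow> 2 * h s \<le> h (s - d) + h (s + d)"
    and t: "0 \<le> t" "t \<le> 1"
  shows "h t \<le> 0"
proof (rule ccontr)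
  assume "\<not> h t \<le> 0"
  obtain m where m: "m \<in> {0..1}" and m_max: "\<And>s. s \<in> {0..1} \<Longrightarrow> h s \<le> h m"
    using continuous_attains_sup[of "{0..1}" h] cont by auto
  have pos: "h m > 0"
    using m_max[of t] t \<open>\<not> h t \<le> 0\<close> by auto
  \<comment> \<open>The set of maximisers is compact, so it has a least element \<open>s\<close>;
    minimality is what makes one of the two estimates below strict.\<close>
  define C where "C = {s \<in> {0..1}. h s = h m}"
  have "closed C"
    unfolding C_def by (intro continuous_closed_preimage_constant cont closed_atLeastAtMost)
  moreover have "bounded C"
    unfolding C_def by (rule bounded_subset[OF bounded_closed_interval]) auto
  ultimately have "compact C"
    by (simp add: compact_eq_bounded_closed)
  moreover have "C \<noteq> {}"
    using m by (auto simp: C_def)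
  ultimately obtain s where s: "s \<in> C" and s_min: "\<And>r. r \<in> C \<Longrightarrow> s \<le> r"
    using compact_attains_inf[of C] by blast
  have hs: "h s = h m" and "s \<noteq> 0" "s \<noteq> 1" "0 \<le> s" "s \<le> 1"
    using s ends pos by (auto simp: C_def)
  then have s01: "0 < s" "s < 1" by auto
  from mid[OF s01] obtain \<delta> where "\<delta> > 0" and \<delta>:
    "\<And>d. 0 < d \<Longrightarrow> d < \<delta> \<Longrightarrow> d \<le> s \<Longrightarrow> d \<le> 1 - s \<Longrightarrow> 2 * h s \<le> h (s - d) + h (s + d)"
    by blast
  \<comment> \<open>Halving \<delta> gives \<open>d < \<delta>\<close>; the other two bounds keep
    \<open>s - d\<close> and \<open>s + d\<close> in the unit interval.\<close>
  define d where "d = min (\<delta> / 2) (min s (1 - s))"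
  have d: "0 < d" "d < \<delta>" "d \<le> s" "d \<le> 1 - s"
    using \<open>\<delta> > 0\<close> s01 by (auto simp: d_def)
  have "h (s - d) \<noteq> h m"
    using s_min[of "s - d"] d s01 by (auto simp: C_def)
  with m_max[of "s - d"] have "h (s - d) < h m"
    using d s01 by auto
  moreover have "h (s + d) \<le> h m"
    using m_max d s01 by auto
  ultimately show False
    using \<delta>[OF d] hs by linarith
qed

lemma locally_convex_imp_interval_convex:
  assumes cont: "continuous_on S f" and loc: "locally_convex_fun_on S f"
  shows "interval_convex_fun_on S f"
  unfolding interval_convex_fun_on_def
proof (intro allI impI)
  fix a b
  assume ab: "closed_segment a b \<subseteq> S"
  have "convex_on (closed_segment a b) f"
  proof (rule convex_onI)
    fix t :: real and x y
    assume t: "0 < t" "t < 1" and xy: "x \<in> closed_segment a b" "y \<in> closed_segment a b"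
    define p where "p s = (1 - s) *\<^sub>R x + s *\<^sub>R y" for s :: real
    \<comment> \<open>The subtracted chord is affine in \<open>s\<close>, so it cancels from
      midpoint inequalities, and \<open>h\<close> vanishes at 0 and 1.\<close>
    define h where "h s = f (p s) - ((1 - s) * f x + s * f y)" for s
    have "closed_segment x y \<subseteq> S"
      using ab xy convex_closed_segment closed_segment_subset by blast
    then have pS: "p s \<in> S" if "0 \<le> s" "s \<le> 1" for s
      using that unfolding p_def by (meson in_segment(1) subsetD)
    have "continuous_on {0..1} (\<lambda>s. f (p s))"
    proof (rule continuous_on_compose2[OF cont])
      show "continuous_on {0..1} p"
        unfolding p_def by (intro continuous_intros)
    qed (auto simp: pS)
    then have h_cont: "continuous_on {0..1} h"
      unfolding h_def by (intro continuous_intros)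
    have "h t \<le> 0"
    proof (rule locally_midpoint_convex_le_0[OF h_cont])
      fix s :: real
      assume s: "0 < s" "s < 1"
      then obtain r where r: "r > 0" "convex_fun_on (ball (p s) r \<inter> S) f"
        using loc pS[of s] unfolding locally_convex_fun_on_def by auto
      \<comment> \<open>Continuity of \<open>p\<close> turns the radius \<open>r\<close> of the ball
        into a bound \<delta> on the parameter: for \<open>d < \<delta>\<close> both
        \<open>p (s - d)\<close> and \<open>p (s + d)\<close> lie in the ball where \<open>f\<close>
        is convex.\<close>
      have "isCont p s"
        unfolding p_def by (intro continuous_intros)
      then obtain \<delta> where \<delta>: "\<delta> > 0" "\<And>u. dist u s < \<delta> \<Longrightarrow> dist (p u) (p s) < r"
        using r(1) unfolding continuous_at_eps_delta dist_real_def by blast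
      have "2 * h s \<le> h (s - d) + h (s + d)"
        if d: "0 < d" "d < \<delta>" "d \<le> s" "d \<le> 1 - s" for d
      proof -
        have "p (s - d) + p (s + d) = 2 *\<^sub>R p s"
          unfolding scaleR_2 by (simp add: p_def algebra_simps)
        then have eq: "(1 - 1/2) *\<^sub>R p (s - d) + (1/2) *\<^sub>R p (s + d) = p s"
          by (simp flip: scaleR_add_right)
        have "p (s - d) \<in> ball (p s) r \<inter> S" "p (s + d) \<in> ball (p s) r \<inter> S"
          "p s \<in> ball (p s) r \<inter> S"
          using pS d s \<delta>(2)[of "s - d"] \<delta>(2)[of "s + d"] r(1)
          by (auto simp: dist_commute dist_real_def)
        then have "f (p s) \<le> (1 - 1/2) * f (p (s - d)) + (1/2) * f (p (s + d))"
          using convex_fun_onD[OF r(2), of "p (s - d)" "p (s + d)" "1/2"] unfolding eq by auto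
        then show ?thesis
          by (simp add: h_def algebra_simps)
      qed
      with \<delta>(1) show "\<exists>\<delta>>0. \<forall>d. 0 < d \<longrightarrow> d < \<delta> \<longrightarrow> d \<le> s \<longrightarrow> d \<le> 1 - s \<longrightarrow>
          2 * h s \<le> h (s - d) + h (s + d)"
        by blast
    qed (use t in \<open>auto simp: h_def p_def\<close>)
    then show "f ((1 - t) *\<^sub>R x + t *\<^sub>R y) \<le> (1 - t) * f x + t * f y"
      by (simp add: h_def p_def)
  qed simp
  then show "convex_fun_on (closed_segment a b) f"
    by (simp add: convex_fun_on_iff_convex_on)
qed

text \<open>The two endpoints are passed to the closure one at a time. With one endpoint and
  \<open>t\<close> fixed, the admissible positions of the other form a closed set, as the preimage
  of \<open>closure E\<close> under a continuous map; containing \<open>E\<close>, it contains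
  \<open>closure E\<close>.\<close>

lemma convex_closureI:
  fixes E :: "'a::real_normed_vector set"
  assumes E: "\<And>u v t. u \<in> E \<Longrightarrow> v \<in> E \<Longrightarrow> 0 \<le> t \<Longrightarrow> t \<le> 1 \<Longrightarrow>
    (1 - t) *\<^sub>R u + t *\<^sub>R v \<in> closure E"
  shows "convex (closure E)"
  unfolding convex_alt
proof (intro ballI allI impI)
  fix u v and t :: real
  assume u: "u \<in> closure E" and v: "v \<in> closure E" and t: "0 \<le> t \<and> t \<le> 1"
  have left: "(1 - t) *\<^sub>R u' + t *\<^sub>R v \<in> closure E" if "u' \<in> E" for u'
  proof -
    have "closed ((\<lambda>v. (1 - t) *\<^sub>R u' + t *\<^sub>R v) -` closure E)"
      by (intro closed_vimage closed_closure continuous_intros)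
    then have "closure E \<subseteq> (\<lambda>v. (1 - t) *\<^sub>R u' + t *\<^sub>R v) -` closure E"
      using E that t by (intro closure_minimal) auto
    with v show ?thesis by auto
  qed
  have "closed ((\<lambda>u. (1 - t) *\<^sub>R u + t *\<^sub>R v) -` closure E)"
    by (intro closed_vimage closed_closure continuous_intros)
  then have "closure E \<subseteq> (\<lambda>u. (1 - t) *\<^sub>R u + t *\<^sub>R v) -` closure E"
    using left by (intro closure_minimal) auto
  with u show "(1 - t) *\<^sub>R u + t *\<^sub>R v \<in> closure E" by auto
qed

text \<open>The inequality \<open>f (fst (u n)) \<le> snd (u n)\<close> survives the limit because
  \<open>f\<close> is continuous on \<open>S\<close> at \<open>x\<close>. Nothing is claimed about
  limit points over the complement of \<open>S\<close>.\<close>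

lemma closure_epigraph_le:
  fixes f :: "'a::real_normed_vector \<Rightarrow> real"
  assumes cont: "continuous_on S f" and "(x, a) \<in> closure (epigraph S f)" "x \<in> S"
  shows "f x \<le> a"
proof -
  obtain u where u: "\<And>n. u n \<in> epigraph S f" "u \<longlonglongrightarrow> (x, a)"
    using assms(2) by (auto simp: closure_sequential)
  then have S: "\<And>n. fst (u n) \<in> S" and le: "\<And>n. f (fst (u n)) \<le> snd (u n)"
    by (auto simp: epigraph_def)
  have lim: "(\<lambda>n. fst (u n)) \<longlonglongrightarrow> x" "(\<lambda>n. snd (u n)) \<longlonglongrightarrow> a"
    using tendsto_fst[OF u(2)] tendsto_snd[OF u(2)] by auto
  then have "(\<lambda>n. f (fst (u n))) \<longlonglongrightarrow> f x"
    using continuous_on_tendsto_compose[OF cont lim(1) assms(3)] S by simp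
  then show ?thesis
    using lim(2) le by (intro LIMSEQ_le) auto
qed

lemma convex_fun_on_if_convex_closure_epigraph:
  fixes f :: "'a::real_normed_vector \<Rightarrow> real"
  assumes cont: "continuous_on S f" and conv: "convex (closure (epigraph S f))"
  shows "convex_fun_on S f"
  unfolding convex_fun_on_def
proof (intro allI impI)
  fix k and c :: "nat \<Rightarrow> real" and p :: "nat \<Rightarrow> 'a"
  assume p: "\<forall>i<k. p i \<in> S \<and> 0 \<le> c i" "(\<Sum>i<k. c i) = 1" "(\<Sum>i<k. c i *\<^sub>R p i) \<in> S"
  have "(p i, f (p i)) \<in> closure (epigraph S f)" if "i < k" for i
    using p that closure_subset[of "epigraph S f"] by (auto simp: epigraph_def)
  then have "(\<Sum>i<k. c i *\<^sub>R (p i, f (p i))) \<in> closure (epigraph S f)"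
    using p by (intro convex_sum[OF _ conv]) auto
  moreover have "(\<Sum>i<k. c i *\<^sub>R (p i, f (p i))) = (\<Sum>i<k. c i *\<^sub>R p i, \<Sum>i<k. c i * f (p i))"
    by (simp add: sum_prod)
  ultimately show "f (\<Sum>i<k. c i *\<^sub>R p i) \<le> (\<Sum>i<k. c i * f (p i))"
    using closure_epigraph_le[OF cont] p(3) by simp
qed

lemma interval_convex_imp_convex:
  fixes f :: "'a::real_normed_vector \<Rightarrow> real"
  assumes "convex \<Omega>" "general_position_in A \<Omega>" and cont: "continuous_on (\<Omega> - A) f"
    and int: "interval_convex_fun_on (\<Omega> - A) f"
  shows "convex_fun_on (\<Omega> - A) f"
proof (rule convex_fun_on_if_convex_closure_epigraph[OF cont], rule convex_closureI)
  let ?E = "epigraph (\<Omega> - A) f"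
  fix u v and t :: real
  assume u: "u \<in> ?E" and v: "v \<in> ?E" and t: "0 \<le> t" "t \<le> 1"
  obtain x a where x: "u = (x, a)" "x \<in> \<Omega> - A" "f x \<le> a"
    using u by (cases u) (auto simp: epigraph_def)
  obtain y b where y: "v = (y, b)" "y \<in> \<Omega> - A" "f y \<le> b"
    using v by (cases v) (auto simp: epigraph_def)
  \<comment> \<open>It suffices to move one endpoint: \<open>x\<close> stays fixed, and
    \<open>y\<close> is approximated by points visible from \<open>x\<close> within \<Omega> off
    \<open>A\<close>.\<close>
  have "\<exists>z\<in>\<Omega>. dist z y < 1 / Suc n \<and> closed_segment x z \<inter> A = {}" for n
    using assms(2) x y unfolding general_position_in_def by simp
  then obtain z where z: "\<And>n. z n \<in> \<Omega>" "\<And>n. dist (z n) y < 1 / Suc n"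
      "\<And>n. closed_segment x (z n) \<inter> A = {}"
    by metis
  have seg: "closed_segment x (z n) \<subseteq> \<Omega> - A" for n
    using z[of n] x assms(1) closed_segment_subset[of x \<Omega> "z n"] by blast
  have "(\<lambda>n. dist (z n) y) \<longlonglongrightarrow> 0"
  proof (rule Lim_null_comparison[OF _ LIMSEQ_inverse_real_of_nat],
      rule always_eventually, rule allI)
    show "norm (dist (z n) y) \<le> inverse (real (Suc n))" for n
      using less_imp_le[OF z(2)] unfolding inverse_eq_divide by simp
  qed
  then have z_lim: "z \<longlonglongrightarrow> y"
    by (rule iffD2[OF tendsto_dist_iff])
  have zS: "z n \<in> \<Omega> - A" for n
    using seg[of n] ends_in_segment(2) by blast
  have f_lim: "(\<lambda>n. f (z n)) \<longlonglongrightarrow> f y"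
    using continuous_on_tendsto_compose[OF cont z_lim y(2)] zS by simp
  \<comment> \<open>The height over \<open>z n\<close> is \<open>b\<close> shifted by
    \<open>f (z n) - f y\<close>: since \<open>f y \<le> b\<close>, it is at least
    \<open>f (z n)\<close>, and it tends to \<open>b\<close> because the shift tends to 0.\<close>
  define w where
    "w n = ((1 - t) *\<^sub>R x + t *\<^sub>R z n, (1 - t) * a + t * (b + (f (z n) - f y)))" for n
  have "w n \<in> ?E" for n
  proof -
    have "(1 - t) *\<^sub>R x + t *\<^sub>R z n \<in> closed_segment x (z n)"
      using t by (auto simp: in_segment)
    moreover have "convex_fun_on (closed_segment x (z n)) f"
      using int seg[of n] by (simp add: interval_convex_fun_on_def)
    ultimately have "f ((1 - t) *\<^sub>R x + t *\<^sub>R z n) \<le> (1 - t) * f x + t * f (z n)"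
      using t by (intro convex_fun_onD) auto
    also have "\<dots> \<le> (1 - t) * a + t * (b + (f (z n) - f y))"
      using t x y by (intro add_mono mult_left_mono) auto
    finally show ?thesis
      using seg[of n] \<open>(1 - t) *\<^sub>R x + t *\<^sub>R z n \<in> closed_segment x (z n)\<close>
      by (auto simp: w_def epigraph_def)
  qed
  moreover have "w \<longlonglongrightarrow> ((1 - t) *\<^sub>R x + t *\<^sub>R y, (1 - t) * a + t * (b + (f y - f y)))"
    unfolding w_def by (intro tendsto_intros z_lim f_lim)
  ultimately show "(1 - t) *\<^sub>R u + t *\<^sub>R v \<in> closure ?E"
    unfolding closure_sequential by (intro exI[of _ w]) (simp add: x y)
qed

theorem theorem5p1:
  fixes \<Omega> A :: "'a::euclidean_space set" and f :: "'a \<Rightarrow> real"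
  assumes "convex \<Omega>" and "closed A" and "general_position_in A \<Omega>"
    and "continuous_on (\<Omega> - A) f"
  shows "(convex_fun_on (\<Omega> - A) f \<longleftrightarrow> locally_convex_fun_on (\<Omega> - A) f)
    \<and> (locally_convex_fun_on (\<Omega> - A) f \<longleftrightarrow> interval_convex_fun_on (\<Omega> - A) f)"
proof -
  \<comment> \<open>Any radius serves here, since convexity restricts to subsets. The equivalences
    then follow from the cycle convex, locally convex, interval convex, convex.\<close>
  have "locally_convex_fun_on (\<Omega> - A) f" if "convex_fun_on (\<Omega> - A) f"
    unfolding locally_convex_fun_on_def
    using convex_fun_on_subset[OF that Int_lower2] zero_less_one by blast
  then show ?thesis
    using locally_convex_imp_interval_convex[OF assms(4)]
      interval_convex_imp_convex[OF assms(1,3,4)] by blast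
qed

end
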